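(* Let $X,Y,Z,W$ be dichotomous ($\pm1$-valued) random variables such that the pairs $X-Z$, $X-W$, $Y-Z$ and $Y-W$ are jointly measurable, with given joint probability distributions $p_{X;Z}$, $p_{X;W}$, $p_{Y;Z}$, $p_{Y;W}$ on $\{\pm1\}^2$. Suppose that the indistinguishability relations $X_Z\equiv X_W$, $Y_Z\equiv Y_W$, $Z_X\equiv Z_Y$ and $W_X\equiv W_Y$ are satisfied. Then there exists a signed probability space $(\Omega,\mathcal{F},\mu)$, with extended random variables representing $X,Y,Z,W$ defined on it, for which each of the pairs $\{X,Z\}$, $\{X,W\}$, $\{Y,Z\}$, $\{Y,W\}$ is a $\mu$-induced context (the probability measure of each context giving the pair its prescribed joint distribution).
   Context: Jointly measurable pair: a pair $X-Z$ is jointly measurable when it comes with a classical joint probability distribution $p_{X;Z}$ of its outcomes (here a probability measure on $\{\pm1\}^2$). No joint distribution of all the variables together is assumed. Notation $X_Z$: the random variable $X$ considered in the context of the joint measurement $X-Z$; similarly $X_W$, $Y_Z$, $Y_W$, $Z_X$, $Z_Y$, $W_X$, $W_Y$. Indistinguishability relation $\equiv$: $X_Z\equiv X_W$ means that the two versions of $X$ can be identified as random variables, i.e. each proposition about $X$ has the same probability in both contexts: $\sum_{b}p_{X;Z}(X=a,Z=b)=\sum_{c}p_{X;W}(X=a,W=c)$ for $a=\pm1$; similarly for the other variables. Signed measure: for a set $\Omega$ and a $\sigma$-algebra $\mathcal{F}$ on $\Omega$, a signed measure is a function $\mu:\mathcal{F}\to\mathbb{R}$ with $\mu(\emptyset)=0$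 and $\mu(\bigcup_i A_i)=\sum_i\mu(A_i)$ for every countable pairwise disjoint family $\{A_i\}_{i\in\mathbb{N}}\subseteq\mathcal{F}$. The triple $(\Omega,\mathcal{F},\mu)$ is called a signed measure space. Extended random variable: given a signed measure space $(\Omega,\mathcal{F},\mu)$ and a Borel space $(M,\mathcal{M})$ with $M\subseteq\mathbb{R}$, a (real-valued) extended random variable is a measurable function $R^*:\Omega\to M$. $\mu$-induced context: let $\{R^*_i\}_{i=1,\dots,n}$ be a collection of extended random variables on a signed measure space $(\Omega,\mathcal{F},\mu)$. A $\mu$-induced context is a subset $C^\mu_j=\{R^*_k\}_{k\in N_j}$, $N_j\subset\{1,\dots,n\}$, for which there exists a sub-$\sigma$-algebra $\mathcal{F}_j$ of $\mathcal{F}$ such that, setting $p^\mu_j(F):=\mu(F)$ for all $F\in\mathcal{F}_j$, the triple $(\Omega,\mathcal{F}_j,p^\mu_j)$ is a probability space and, for every $k\in N_j$, $R^*_k$ is a random variable on it (i.e. is $\mathcal{F}_j$-measurable). Signed (or negative) probability space: a signed measure space $(\Omega,\mathcal{F},\mu)$ endowed with a non-empty set of contexts (in the sense just defined) and such that $\mu(\Omega)=1$. *)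

theory Defs
  imports "HOL-Probability.Probability"
begin

definition signed_measure_space :: "'w set \<Rightarrow> 'w set set \<Rightarrow> ('w set \<Rightarrow> real) \<Rightarrow> bool" where
  "signed_measure_space \<Omega> F \<mu> \<longleftrightarrow>
     sigma_algebra \<Omega> F \<and> \<mu> {} = 0 \<and>
     (\<forall>A :: nat \<Rightarrow> 'w set. range A \<subseteq> F \<longrightarrow> disjoint_family A \<longrightarrow>
        (\<lambda>i. \<mu> (A i)) sums \<mu> (\<Union>i. A i))"

(* Only the measurable space (\<Omega>, F) matters here: sigma \<Omega> F carries the zero measure. *)
definition extended_random_variable :: "'w set \<Rightarrow> 'w set set \<Rightarrow> real set \<Rightarrow> ('w \<Rightarrow> real) \<Rightarrow> bool" where
  "extended_random_variable \<Omega> F S R \<longleftrightarrow> R \<in> sigma \<Omega> F \<rightarrow>\<^sub>M restrict_space borel S"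

(* P is the probability space (\<Omega>, F_j, p_j) of the context indexed by N: its family of
   measurable sets is the sub-sigma-algebra F_j = sets P, on which it agrees with the
   real-valued \<mu> (so in particular \<mu> is nonnegative on F_j). *)
definition context_prob_space ::
  "'w set \<Rightarrow> 'w set set \<Rightarrow> ('w set \<Rightarrow> real) \<Rightarrow> ('i \<Rightarrow> real set) \<Rightarrow> ('i \<Rightarrow> 'w \<Rightarrow> real)
     \<Rightarrow> 'i set \<Rightarrow> 'w measure \<Rightarrow> bool" where
  "context_prob_space \<Omega> F \<mu> S R N P \<longleftrightarrow>
     prob_space P \<and> space P = \<Omega> \<and> sets P \<subseteq> F \<and>
     (\<forall>A\<in>sets P. measure P A = \<mu> A) \<and>
     (\<forall>k\<in>N. R k \<in> P \<rightarrow>\<^sub>M restrict_space borel (S k))"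

definition induced_context ::
  "'w set \<Rightarrow> 'w set set \<Rightarrow> ('w set \<Rightarrow> real) \<Rightarrow> 'i set \<Rightarrow> ('i \<Rightarrow> real set) \<Rightarrow> ('i \<Rightarrow> 'w \<Rightarrow> real)
     \<Rightarrow> 'i set \<Rightarrow> bool" where
  "induced_context \<Omega> F \<mu> I S R N \<longleftrightarrow>
     N \<subseteq> I \<and> (\<exists>P. context_prob_space \<Omega> F \<mu> S R N P)"

(* (R k) for k in the finite index set I are the extended random variables, S k is the value
   space of R k, and \<C> is the set of contexts, each given by its index set. *)
definition signed_prob_space ::
  "'w set \<Rightarrow> 'w set set \<Rightarrow> ('w set \<Rightarrow> real) \<Rightarrow> 'i set \<Rightarrow> ('i \<Rightarrow> real set) \<Rightarrow> ('i \<Rightarrow> 'w \<Rightarrow> real)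
     \<Rightarrow> 'i set set \<Rightarrow> bool" where
  "signed_prob_space \<Omega> F \<mu> I S R \<C> \<longleftrightarrow>
     signed_measure_space \<Omega> F \<mu> \<and>
     finite I \<and> (\<forall>k\<in>I. extended_random_variable \<Omega> F (S k) (R k)) \<and>
     \<C> \<noteq> {} \<and> (\<forall>N\<in>\<C>. induced_context \<Omega> F \<mu> I S R N) \<and>
     \<mu> \<Omega> = 1"

abbreviation pm1 :: "real set" where "pm1 \<equiv> {-1, 1}"

definition joint_distribution :: "(real \<times> real) measure \<Rightarrow> bool" where
  "joint_distribution p \<longleftrightarrow> prob_space p \<and> sets p = Pow (pm1 \<times> pm1)"

(* Indistinguishability of the two versions of a variable that is the first (respectively
   the second) component of both joint distributions. *)
definition indist_fst :: "(real \<times> real) measure \<Rightarrow> (real \<times> real) measure \<Rightarrow> bool" where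
  "indist_fst p q \<longleftrightarrow>
     (\<forall>a\<in>pm1. (\<Sum>b\<in>pm1. measure p {(a, b)}) = (\<Sum>c\<in>pm1. measure q {(a, c)}))"

definition indist_snd :: "(real \<times> real) measure \<Rightarrow> (real \<times> real) measure \<Rightarrow> bool" where
  "indist_snd p q \<longleftrightarrow>
     (\<forall>b\<in>pm1. (\<Sum>a\<in>pm1. measure p {(a, b)}) = (\<Sum>c\<in>pm1. measure q {(c, b)}))"

datatype dvar = vX | vY | vZ | vW

definition context_with_distribution ::
  "'w set \<Rightarrow> 'w set set \<Rightarrow> ('w set \<Rightarrow> real) \<Rightarrow> ('i \<Rightarrow> real set) \<Rightarrow> ('i \<Rightarrow> 'w \<Rightarrow> real)
     \<Rightarrow> 'i \<Rightarrow> 'i \<Rightarrow> (real \<times> real) measure \<Rightarrow> bool" where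
  "context_with_distribution \<Omega> F \<mu> S R i j p \<longleftrightarrow>
     (\<exists>P. context_prob_space \<Omega> F \<mu> S R {i, j} P \<and>
          distr P (count_space (S i \<times> S j)) (\<lambda>\<omega>. (R i \<omega>, R j \<omega>)) = p)"

end

theory Submission
  imports Defs
begin

text \<open>
  Take \<open>\<Omega> = {-1, 1}\<^sup>4\<close> with all subsets measurable, and give it the signed density which agrees with the
  prescribed first moments and the four prescribed second moments and has vanishing correlations
  otherwise (\<open>XY\<close>, \<open>ZW\<close> and all products of three or four variables). By the indistinguishability
  relations the first moments are well defined; the pair marginals are then the given
  distributions. Written without moments, the density is a quarter of the sum of the pair
  probabilities, minus an eighth of the sum of the single probabilities, plus \<open>1/16\<close>. The context
  of a pair is the \<open>\<sigma>\<close>-algebra generated by it, on which the signed measure is the pull-back of the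
  joint distribution.
\<close>

text \<open>In a finite \<Omega> only finitely many members of a disjoint family are nonempty,
  because nonempty disjoint sets are distinct. So the series has finitely many nonzero terms, and
  countable additivity reduces to finite additivity of sums.\<close>

lemma signed_measure_space_sum:
  fixes f :: "'w \<Rightarrow> real"
  assumes fin: "finite \<Omega>"
  shows "signed_measure_space \<Omega> (Pow \<Omega>) (sum f)"
proof -
  have "(\<lambda>i. sum f (A i)) sums sum f (\<Union>i. A i)"
    if A: "range A \<subseteq> Pow \<Omega>" and disj: "disjoint_family A" for A :: "nat \<Rightarrow> 'w set"
  proof -
    define N where "N = {i. A i \<noteq> {}}"
    have "inj_on A N"
      using disj unfolding inj_on_def N_def disjoint_family_on_def
      by (metis Int_absorb UNIV_I mem_Collect_eq)
    moreover have "finite (A ` N)"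
      using A fin by (meson finite_Pow_iff finite_subset image_mono subset_UNIV)
    ultimately have N: "finite N"
      using finite_imageD by blast
    have "(\<lambda>i. sum f (A i)) sums (\<Sum>i\<in>N. sum f (A i))"
      using N by (intro sums_finite) (auto simp: N_def)
    also have "(\<Sum>i\<in>N. sum f (A i)) = sum f (\<Union>i\<in>N. A i)"
    proof (rule sum.UNION_disjoint[symmetric])
      show "\<forall>i\<in>N. finite (A i)"
        using A fin by (auto intro: finite_subset)
      show "\<forall>i\<in>N. \<forall>j\<in>N. i \<noteq> j \<longrightarrow> A i \<inter> A j = {}"
        using disj by (auto simp: disjoint_family_on_def)
    qed (fact N)
    also have "(\<Union>i\<in>N. A i) = (\<Union>i. A i)"
      by (auto simp: N_def)
    finally show ?thesis .
  qed
  then show ?thesis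
    by (simp add: signed_measure_space_def sigma_algebra_Pow)
qed

text \<open>Every event about the pair is a union of its fibres. If the fibre sums of
  \<open>f\<close> are the prescribed probabilities, \<open>sum f\<close> is a probability on these
  events even where \<open>f\<close> itself is negative. This reduces each context to an identity
  between finite sums.\<close>

lemma context_with_distribution_sum:
  fixes f :: "'w \<Rightarrow> real"
  assumes fin: "finite \<Omega>" and p: "joint_distribution p"
    and surj: "(\<lambda>\<omega>. (R i \<omega>, R j \<omega>)) ` \<Omega> = pm1 \<times> pm1"
    and marginal: "\<And>a b. a \<in> pm1 \<Longrightarrow> b \<in> pm1 \<Longrightarrow>
      sum f {\<omega>\<in>\<Omega>. R i \<omega> = a \<and> R j \<omega> = b} = measure p {(a, b)}"
  shows "context_with_distribution \<Omega> (Pow \<Omega>) (sum f) (\<lambda>_. pm1) R i j p"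
proof -
  interpret p: prob_space p
    using p by (simp add: joint_distribution_def)
  have sets_p: "sets p = Pow (pm1 \<times> pm1)"
    using p by (simp add: joint_distribution_def)
  have space_p: "space p = pm1 \<times> pm1"
    using sets_eq_imp_space_eq[of p "count_space (pm1 \<times> pm1)"] sets_p by simp
  define T where "T = (\<lambda>\<omega>. (R i \<omega>, R j \<omega>))"
  define s where "s = inv_into \<Omega> T"
  have surj_T: "T ` \<Omega> = space p"
    using surj by (simp add: T_def space_p)
  have s: "s x \<in> \<Omega>" "T (s x) = x" if "x \<in> space p" for x
    using that surj_T unfolding s_def by (auto intro: inv_into_into f_inv_into_f)
  have T: "T \<in> \<Omega> \<rightarrow> space p"
    using surj_T by auto
  \<comment> \<open>the unique measure on the \<open>\<sigma>\<close>-algebra generated by \<open>T\<close> whose image under \<open>T\<close> is \<open>p\<close>, obtained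
    by transporting \<open>p\<close> along a section of \<open>T\<close>\<close>
  define V where "V = vimage_algebra \<Omega> T p"
  define P where "P = distr p V s"
  have T_V: "T \<in> V \<rightarrow>\<^sub>M p"
    unfolding V_def by (rule measurable_vimage_algebra1[OF T])
  \<comment> \<open>Measurability into a pulled-back sigma-algebra is tested after composing with
    \<open>T\<close>, and \<open>T\<close> after \<open>s\<close> is the identity on the
    outcomes.\<close>
  have s_V: "s \<in> p \<rightarrow>\<^sub>M V"
    unfolding V_def
  proof (rule measurable_vimage_algebra2)
    show "(\<lambda>x. T (s x)) \<in> p \<rightarrow>\<^sub>M p"
      using measurable_ident by (rule measurable_cong[THEN iffD1, rotated]) (simp add: s)
  qed (auto simp: s)
  have space_P: "space P = \<Omega>" and sets_P: "sets P = sets V"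
    by (simp_all add: P_def V_def)
  have prob: "prob_space P"
    unfolding P_def by (rule p.prob_space_distr[OF s_V])
  have meas: "measure P A = sum f A" if "A \<in> sets P" for A
  proof -
    obtain B where B: "B \<in> sets p" and A: "A = T -` B \<inter> \<Omega>"
      using \<open>A \<in> sets P\<close> by (auto simp: sets_P V_def sets_vimage_algebra2[OF T])
    have "B \<subseteq> space p"
      using B by (rule sets.sets_into_space)
    then have finB: "finite B"
      by (rule finite_subset) (simp add: space_p)
    \<comment> \<open>The choice of section is immaterial: \<open>A\<close> is a full preimage under
      \<open>T\<close>, so \<open>s\<close> sends an outcome into \<open>A\<close> exactly when it
      lies in \<open>B\<close>.\<close>
    have "s -` A \<inter> space p = B"
      using \<open>B \<subseteq> space p\<close> by (auto simp: A s)
    then have "measure P A = measure p B"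
      using that by (simp add: P_def measure_distr[OF s_V])
    also have "\<dots> = (\<Sum>x\<in>B. measure p {x})"
      using finB \<open>B \<subseteq> space p\<close>
      by (intro p.finite_measure_eq_sum_singleton) (auto simp: sets_p space_p)
    \<comment> \<open>The fibre over each outcome in \<open>B\<close> lies entirely in
      \<open>A\<close>, so \<open>marginal\<close> gives its sum; the fibres then regroup to
      \<open>A\<close>.\<close>
    also have "\<dots> = (\<Sum>x\<in>B. sum f {\<omega>\<in>A. T \<omega> = x})"
    proof (rule sum.cong[OF refl])
      fix x assume "x \<in> B"
      then have x: "fst x \<in> pm1" "snd x \<in> pm1"
        using \<open>B \<subseteq> space p\<close> unfolding space_p by auto
      have "{\<omega>\<in>A. T \<omega> = x} = {\<omega>\<in>\<Omega>. R i \<omega> = fst x \<and> R j \<omega> = snd x}"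
        using \<open>x \<in> B\<close> by (auto simp: A T_def)
      then show "measure p {x} = sum f {\<omega>\<in>A. T \<omega> = x}"
        using marginal[OF x] by simp
    qed
    also have "\<dots> = sum f A"
      using fin finB by (intro sum.group) (auto simp: A)
    finally show ?thesis .
  qed
  have Rk: "R k \<in> P \<rightarrow>\<^sub>M restrict_space borel pm1" if "k \<in> {i, j}" for k
  proof -
    have TP: "T \<in> P \<rightarrow>\<^sub>M p"
      using T_V by (simp add: P_def)
    have "fst \<in> p \<rightarrow>\<^sub>M restrict_space borel pm1" "snd \<in> p \<rightarrow>\<^sub>M restrict_space borel pm1"
      by (auto simp: measurable_def sets_p space_p space_restrict_space)
    from this[THEN measurable_compose[OF TP]] that show ?thesis
      by (auto simp: T_def)
  qed
  have "context_prob_space \<Omega> (Pow \<Omega>) (sum f) (\<lambda>_. pm1) R {i, j} P"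
    unfolding context_prob_space_def
    using prob space_P meas Rk sets.sets_into_space[of _ P] by auto
  moreover have "distr P (count_space (pm1 \<times> pm1)) T = p"
  proof -
    have "sets (count_space (pm1 \<times> pm1)) = sets p"
      by (simp add: sets_p)
    then have "distr P (count_space (pm1 \<times> pm1)) T = distr P p T"
      by (intro distr_cong) auto
    also have "\<dots> = distr p p (T \<circ> s)"
      unfolding P_def by (rule distr_distr[OF T_V s_V])
    also have "\<dots> = distr p p (\<lambda>x. x)"
      by (intro distr_cong) (auto simp: s)
    finally show ?thesis
      by simp
  qed
  ultimately show ?thesis
    unfolding context_with_distribution_def T_def by blast
qed

text \<open>Each single-variable term occurs in two pair tables; the eighth removes the surplus copy
  and \<open>1 / 16\<close> restores the constant term. The arguments are the tables of XZ, XW, YZ,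
  YW. The single probabilities are read from one table each, a choice that indistinguishability
  makes immaterial.\<close>

definition glued_density ::
  "(real \<Rightarrow> real \<Rightarrow> real) \<Rightarrow> (real \<Rightarrow> real \<Rightarrow> real) \<Rightarrow> (real \<Rightarrow> real \<Rightarrow> real) \<Rightarrow> (real \<Rightarrow> real \<Rightarrow> real)
     \<Rightarrow> real \<times> real \<times> real \<times> real \<Rightarrow> real" where
  "glued_density p q r s = (\<lambda>(x, y, z, w).
     (p x z + q x w + r y z + s y w) / 4
     - ((\<Sum>b\<in>pm1. p x b) + (\<Sum>b\<in>pm1. r y b) + (\<Sum>a\<in>pm1. p a z) + (\<Sum>a\<in>pm1. q a w)) / 8
     + 1 / 16)"

text \<open>Summing out two variables leaves the wanted table, plus halves of single marginals that
  cancel by indistinguishability, plus the constants 1/4 - 1/2 + 1/4 = 0. Normalising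
  \<open>p\<close> suffices, since equal marginals carry total mass 1 over to the other
  tables.\<close>

lemma glued_density_marginals:
  assumes X: "\<forall>a\<in>pm1. (\<Sum>b\<in>pm1. p a b) = (\<Sum>b\<in>pm1. q a b)"
    and Y: "\<forall>a\<in>pm1. (\<Sum>b\<in>pm1. r a b) = (\<Sum>b\<in>pm1. s a b)"
    and Z: "\<forall>b\<in>pm1. (\<Sum>a\<in>pm1. p a b) = (\<Sum>a\<in>pm1. r a b)"
    and W: "\<forall>b\<in>pm1. (\<Sum>a\<in>pm1. q a b) = (\<Sum>a\<in>pm1. s a b)"
    and total: "(\<Sum>a\<in>pm1. \<Sum>b\<in>pm1. p a b) = 1"
    and ab: "a \<in> pm1" "b \<in> pm1"
  shows "(\<Sum>y\<in>pm1. \<Sum>w\<in>pm1. glued_density p q r s (a, y, b, w)) = p a b"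
    and "(\<Sum>y\<in>pm1. \<Sum>z\<in>pm1. glued_density p q r s (a, y, z, b)) = q a b"
    and "(\<Sum>x\<in>pm1. \<Sum>w\<in>pm1. glued_density p q r s (x, a, b, w)) = r a b"
    and "(\<Sum>x\<in>pm1. \<Sum>z\<in>pm1. glued_density p q r s (x, a, z, b)) = s a b"
  using X Y Z W total ab
  by (auto simp: glued_density_def field_simps)

theorem proposition7:
  fixes pXZ pXW pYZ pYW :: "(real \<times> real) measure"
  assumes "joint_distribution pXZ" and "joint_distribution pXW"
    and "joint_distribution pYZ" and "joint_distribution pYW"
    and X: "indist_fst pXZ pXW" and Y: "indist_fst pYZ pYW"
    and Z: "indist_snd pXZ pYZ" and W: "indist_snd pXW pYW"
  shows "\<exists>(\<Omega> :: (real \<times> real \<times> real \<times> real) set) F \<mu> (R :: dvar \<Rightarrow> _ \<Rightarrow> real).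
    signed_prob_space \<Omega> F \<mu> UNIV (\<lambda>_. pm1) R {{vX, vZ}, {vX, vW}, {vY, vZ}, {vY, vW}} \<and>
    context_with_distribution \<Omega> F \<mu> (\<lambda>_. pm1) R vX vZ pXZ \<and>
    context_with_distribution \<Omega> F \<mu> (\<lambda>_. pm1) R vX vW pXW \<and>
    context_with_distribution \<Omega> F \<mu> (\<lambda>_. pm1) R vY vZ pYZ \<and>
    context_with_distribution \<Omega> F \<mu> (\<lambda>_. pm1) R vY vW pYW"
proof -
  define \<Omega> where "\<Omega> = pm1 \<times> pm1 \<times> pm1 \<times> pm1"
  define f where "f = glued_density (\<lambda>a b. measure pXZ {(a, b)}) (\<lambda>a b. measure pXW {(a, b)})
    (\<lambda>a b. measure pYZ {(a, b)}) (\<lambda>a b. measure pYW {(a, b)})"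
  define R :: "dvar \<Rightarrow> real \<times> real \<times> real \<times> real \<Rightarrow> real" where
    "R = (\<lambda>k (x, y, z, w). case k of vX \<Rightarrow> x | vY \<Rightarrow> y | vZ \<Rightarrow> z | vW \<Rightarrow> w)"
  have R[simp]: "R vX (x, y, z, w) = x" "R vY (x, y, z, w) = y"
    "R vZ (x, y, z, w) = z" "R vW (x, y, z, w) = w" for x y z w
    by (simp_all add: R_def)
  have fin: "finite \<Omega>"
    by (simp add: \<Omega>_def)
  have total: "(\<Sum>a\<in>pm1. \<Sum>b\<in>pm1. measure pXZ {(a, b)}) = 1"
  proof -
    interpret prob_space pXZ
      using assms(1) by (simp add: joint_distribution_def)
    have sets_eq: "sets pXZ = Pow (pm1 \<times> pm1)"
      using assms(1) by (simp add: joint_distribution_def)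
    then have "space pXZ = pm1 \<times> pm1"
      using sets_eq_imp_space_eq[of pXZ "count_space (pm1 \<times> pm1)"] by simp
    moreover have "measure pXZ (pm1 \<times> pm1) = (\<Sum>x\<in>pm1 \<times> pm1. measure pXZ {x})"
      by (intro finite_measure_eq_sum_singleton) (auto simp: sets_eq)
    ultimately show ?thesis
      using prob_space by (simp add: sum.cartesian_product)
  qed
  note marginals = glued_density_marginals[of "\<lambda>a b. measure pXZ {(a, b)}" "\<lambda>a b. measure pXW {(a, b)}"
      "\<lambda>a b. measure pYZ {(a, b)}" "\<lambda>a b. measure pYW {(a, b)}",
      OF X[unfolded indist_fst_def] Y[unfolded indist_fst_def]
         Z[unfolded indist_snd_def] W[unfolded indist_snd_def] total,
      folded f_def]
  \<comment> \<open>When \<open>Q\<close> fixes two coordinates, the conditional collapses two of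
    the four sums, leaving the double sums of \<open>marginals\<close>.\<close>
  have sum_\<Omega>: "sum f {\<omega>\<in>\<Omega>. Q \<omega>} =
    (\<Sum>x\<in>pm1. \<Sum>y\<in>pm1. \<Sum>z\<in>pm1. \<Sum>w\<in>pm1. if Q (x, y, z, w) then f (x, y, z, w) else 0)" for Q
  proof -
    have "sum f {\<omega>\<in>\<Omega>. Q \<omega>} = (\<Sum>\<omega>\<in>\<Omega>. if Q \<omega> then f \<omega> else 0)"
      using fin by (rule sum.inter_filter)
    then show ?thesis
      unfolding \<Omega>_def by (simp only: sum.cartesian_product[symmetric] sum.cartesian_product' prod.case)
  qed
  have XZ: "context_with_distribution \<Omega> (Pow \<Omega>) (sum f) (\<lambda>_. pm1) R vX vZ pXZ"
  proof (rule context_with_distribution_sum[OF fin assms(1)])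
    show "(\<lambda>\<omega>. (R vX \<omega>, R vZ \<omega>)) ` \<Omega> = pm1 \<times> pm1"
      by (auto simp: \<Omega>_def image_iff)
    show "sum f {\<omega>\<in>\<Omega>. R vX \<omega> = a \<and> R vZ \<omega> = b} = measure pXZ {(a, b)}"
      if "a \<in> pm1" "b \<in> pm1" for a b
      using marginals(1)[OF that] that unfolding sum_\<Omega> by auto
  qed
  have XW: "context_with_distribution \<Omega> (Pow \<Omega>) (sum f) (\<lambda>_. pm1) R vX vW pXW"
  proof (rule context_with_distribution_sum[OF fin assms(2)])
    show "(\<lambda>\<omega>. (R vX \<omega>, R vW \<omega>)) ` \<Omega> = pm1 \<times> pm1"
      by (auto simp: \<Omega>_def image_iff)
    show "sum f {\<omega>\<in>\<Omega>. R vX \<omega> = a \<and> R vW \<omega> = b} = measure pXW {(a, b)}"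
      if "a \<in> pm1" "b \<in> pm1" for a b
      using marginals(2)[OF that] that unfolding sum_\<Omega> by auto
  qed
  have YZ: "context_with_distribution \<Omega> (Pow \<Omega>) (sum f) (\<lambda>_. pm1) R vY vZ pYZ"
  proof (rule context_with_distribution_sum[OF fin assms(3)])
    show "(\<lambda>\<omega>. (R vY \<omega>, R vZ \<omega>)) ` \<Omega> = pm1 \<times> pm1"
      by (auto simp: \<Omega>_def image_iff)
    show "sum f {\<omega>\<in>\<Omega>. R vY \<omega> = a \<and> R vZ \<omega> = b} = measure pYZ {(a, b)}"
      if "a \<in> pm1" "b \<in> pm1" for a b
      using marginals(3)[OF that] that unfolding sum_\<Omega> by auto
  qed
  have YW: "context_with_distribution \<Omega> (Pow \<Omega>) (sum f) (\<lambda>_. pm1) R vY vW pYW"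
  proof (rule context_with_distribution_sum[OF fin assms(4)])
    show "(\<lambda>\<omega>. (R vY \<omega>, R vW \<omega>)) ` \<Omega> = pm1 \<times> pm1"
      by (auto simp: \<Omega>_def image_iff)
    show "sum f {\<omega>\<in>\<Omega>. R vY \<omega> = a \<and> R vW \<omega> = b} = measure pYW {(a, b)}"
      if "a \<in> pm1" "b \<in> pm1" for a b
      using marginals(4)[OF that] that unfolding sum_\<Omega> by auto
  qed
  have induced: "induced_context \<Omega> (Pow \<Omega>) (sum f) UNIV (\<lambda>_. pm1) R {i, j}"
    if "context_with_distribution \<Omega> (Pow \<Omega>) (sum f) (\<lambda>_. pm1) R i j p" for i j p
    using that by (auto simp: context_with_distribution_def induced_context_def)
  have "R k \<in> sigma \<Omega> (Pow \<Omega>) \<rightarrow>\<^sub>M restrict_space borel pm1" for k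
    by (rule measurableI) (cases k; auto simp: \<Omega>_def space_restrict_space sigma_algebra.sigma_sets_eq[OF sigma_algebra_Pow])+
  \<comment> \<open>Normalisation needs no computation: \<Omega> is an event of the XZ context,
    where \<open>sum f\<close> agrees with a probability measure.\<close>
  moreover have "sum f \<Omega> = 1"
  proof -
    obtain P where P: "context_prob_space \<Omega> (Pow \<Omega>) (sum f) (\<lambda>_. pm1) R {vX, vZ} P"
      using XZ by (auto simp: context_with_distribution_def)
    then have "measure P \<Omega> = sum f \<Omega>" "measure P \<Omega> = 1"
      unfolding context_prob_space_def using prob_space.prob_space sets.top by metis+
    then show ?thesis by simp
  qed
  moreover have "finite (UNIV :: dvar set)"
    by (rule finite_subset[of _ "{vX, vY, vZ, vW}"]) (auto intro: dvar.exhaust)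
  ultimately have "signed_prob_space \<Omega> (Pow \<Omega>) (sum f) UNIV (\<lambda>_. pm1) R
      {{vX, vZ}, {vX, vW}, {vY, vZ}, {vY, vW}}"
    unfolding signed_prob_space_def extended_random_variable_def
    using signed_measure_space_sum[OF fin] XZ[THEN induced] XW[THEN induced] YZ[THEN induced]
      YW[THEN induced] by auto
  then show ?thesis
    using XZ XW YZ YW by blast
qed

end
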